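(* Let $\lambda>0$ and $c>0$, and let $\mathrm d(P_0P_t)$ be the distance from the starting point $P_0$ of the current position $P_t$, at time $t\ge 0$, of the particle performing the random motion on the unit sphere described in the context. The mean value $E(t)=E\{\cos \mathrm d(P_0P_t)\}$ satisfies $$\frac{\mathrm d^2}{\mathrm dt^2}E=-\lambda\frac{\mathrm d}{\mathrm dt}E-c^2E,\qquad t>0,$$ with initial conditions $E(0)=1$ and $\left.\frac{\mathrm d}{\mathrm dt}E(t)\right|_{t=0}=0$ (right derivative), and has the form $$E(t)=\begin{cases} e^{-\frac{\lambda t}{2}}\left[\cosh\frac t2\sqrt{\lambda^2-4c^2}+\frac{\lambda}{\sqrt{\lambda^2-4c^2}}\sinh\frac t2\sqrt{\lambda^2-4c^2}\right] & \text{if } 0<2c<\lambda,\\[4pt] e^{-\frac{\lambda t}{2}}\left[1+\frac{\lambda t}{2}\right] & \text{if } \lambda=2c>0,\\[4pt] e^{-\frac{\lambda t}{2}}\left[\cos\frac t2\sqrt{4c^2-\lambda^2}+\frac{\lambda}{\sqrt{4c^2-\lambda^2}}\sin\frac t2\sqrt{4c^2-\lambda^2}\right] & \text{if } 2c>\lambda>0.\end{cases}$$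
   Context: A particle moves on the surface of the unit-radius sphere in three-dimensional space with constant speed $c>0$ along great circles. It starts at a point $P_0$ on the equator and initially moves along the equator in one of the two possible directions. Changes of direction occur at the event times $0<T_1<T_2<\cdots$ of a homogeneous Poisson process $N(t)$ of rate $\lambda>0$: at time $T_n$ the particle is at a point $P_n$ and starts moving, in one of the two possible directions, along the great circle through $P_n$ orthogonal to the great circle through $P_0$ and $P_n$ (in particular, at $T_1$ it moves onto the meridian through $P_1$). The distance $\mathrm d(P_0P_t)\in[0,\pi]$ is the length of the shortest great-circle arc joining $P_0$ and $P_t$. By the spherical Pythagorean relationship, on $\{N(t)=n\}$ and with $T_0=0$, $$\cos \mathrm d(P_0P_t)=\cos c(t-T_n)\prod_{k=1}^{n}\cos c(T_k-T_{k-1}).$$ *)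

theory Defs
  imports "HOL-Probability.Probability"
begin

text \<open>A great circle is represented by a unit normal vector of its plane.\<close>

definition great_circle :: "real^3 \<Rightarrow> (real^3) set" where
  "great_circle u = {x \<in> sphere 0 1. u \<bullet> x = 0}"

definition equator :: "(real^3) set" where
  "equator = {x \<in> sphere 0 1. x $ 3 = 0}"

text \<open>Two great circles cross at right angles iff the planes containing them are
  perpendicular, i.e. iff their normals are.\<close>

definition orthogonal_great_circles :: "(real^3) set \<Rightarrow> (real^3) set \<Rightarrow> bool" where
  "orthogonal_great_circles C D \<longleftrightarrow>
     (\<exists>u w. norm u = 1 \<and> norm w = 1 \<and> C = great_circle u \<and> D = great_circle w \<and> u \<bullet> w = 0)"

text \<open>The point reached from \<open>p\<close> after travelling a length \<open>s\<close> along the great circle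
  that leaves \<open>p\<close> with unit tangent vector \<open>v\<close>.\<close>

definition along_great_circle :: "real^3 \<Rightarrow> real^3 \<Rightarrow> real \<Rightarrow> real^3" where
  "along_great_circle p v s = cos s *\<^sub>R p + sin s *\<^sub>R v"

text \<open>The length of the shortest great-circle arc joining two points of the unit sphere.\<close>

definition sphere_dist :: "real^3 \<Rightarrow> real^3 \<Rightarrow> real" where
  "sphere_dist p q =
     Inf {s. 0 \<le> s \<and> (\<exists>v. norm v = 1 \<and> v \<bullet> p = 0 \<and> along_great_circle p v s = q)}"

locale homogeneous_poisson_process = prob_space M
  for M :: "'a measure" +
  fixes rate :: real and N :: "real \<Rightarrow> 'a \<Rightarrow> nat"
  assumes rate_pos: "0 < rate"
    and N_measurable: "\<And>t. 0 \<le> t \<Longrightarrow> N t \<in> measurable M (count_space UNIV)"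
    and N_0: "\<And>\<omega>. \<omega> \<in> space M \<Longrightarrow> N 0 \<omega> = 0"
    and N_mono: "\<And>\<omega> s t. \<omega> \<in> space M \<Longrightarrow> 0 \<le> s \<Longrightarrow> s \<le> t \<Longrightarrow> N s \<omega> \<le> N t \<omega>"
    and poisson_increments: "\<And>s t. 0 \<le> s \<Longrightarrow> s < t \<Longrightarrow>
      distr M (count_space UNIV) (\<lambda>\<omega>. N t \<omega> - N s \<omega>) = measure_pmf (poisson_pmf (rate * (t - s)))"
    and indep_increments: "\<And>(\<tau> :: nat \<Rightarrow> real) k. 0 \<le> \<tau> 0 \<Longrightarrow> strict_mono \<tau> \<Longrightarrow>
      indep_vars (\<lambda>_. count_space UNIV) (\<lambda>i \<omega>. N (\<tau> (Suc i)) \<omega> - N (\<tau> i) \<omega>) {..<k}"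

text \<open>\<open>T n\<close> is the time of the \<open>n\<close>-th event, with the convention \<open>T 0 = 0\<close>, and \<open>X t\<close> is the
  position at time \<open>t\<close>. Between the times \<open>T n\<close> and \<open>T (Suc n)\<close> the particle moves on the great
  circle \<open>C n\<close>, starting at \<open>X (T n)\<close> in the direction of the tangent vector \<open>V n\<close>. The conditions
  on \<open>V n\<close> leave exactly the two directions of travel along \<open>C n\<close>, and nothing is assumed about
  how the choice between them is made. When \<open>X (T n) = \<plusminus> P0\<close>, the great circle through \<open>P0\<close> and
  \<open>X (T n)\<close> is not unique and any of them may serve as the reference circle \<open>D\<close>; this event has
  probability 0.\<close>

locale orthogonal_sphere_motion = homogeneous_poisson_process M rate N
  for M :: "'a measure" and rate :: real and N :: "real \<Rightarrow> 'a \<Rightarrow> nat" +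
  fixes c :: real
    and T :: "nat \<Rightarrow> 'a \<Rightarrow> real"
    and P0 :: "real^3"
    and C :: "nat \<Rightarrow> 'a \<Rightarrow> (real^3) set"
    and V :: "nat \<Rightarrow> 'a \<Rightarrow> real^3"
    and X :: "real \<Rightarrow> 'a \<Rightarrow> real^3"
  assumes c_pos: "0 < c"
    and T_0: "\<And>\<omega>. \<omega> \<in> space M \<Longrightarrow> T 0 \<omega> = 0"
    and T_strict_mono: "\<And>\<omega>. \<omega> \<in> space M \<Longrightarrow> strict_mono (\<lambda>n. T n \<omega>)"
    and T_finite: "\<And>\<omega> t. \<omega> \<in> space M \<Longrightarrow> finite {n. T n \<omega> \<le> t}"
    and N_counts: "\<And>\<omega> t. \<omega> \<in> space M \<Longrightarrow> 0 \<le> t \<Longrightarrow> N t \<omega> = card {n. 1 \<le> n \<and> T n \<omega> \<le> t}"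
    and P0_equator: "P0 \<in> equator"
    and X_measurable: "\<And>t. 0 \<le> t \<Longrightarrow> X t \<in> borel_measurable M"
    and X_0: "\<And>\<omega>. \<omega> \<in> space M \<Longrightarrow> X 0 \<omega> = P0"
    and C_0: "\<And>\<omega>. \<omega> \<in> space M \<Longrightarrow> C 0 \<omega> = equator"
    and C_turn: "\<And>\<omega> n. \<omega> \<in> space M \<Longrightarrow> 1 \<le> n \<Longrightarrow>
      X (T n \<omega>) \<omega> \<in> C n \<omega> \<and>
      (\<exists>D. P0 \<in> D \<and> X (T n \<omega>) \<omega> \<in> D \<and> orthogonal_great_circles D (C n \<omega>))"
    and V_direction: "\<And>\<omega> n. \<omega> \<in> space M \<Longrightarrow> V n \<omega> \<in> C n \<omega> \<and> V n \<omega> \<bullet> X (T n \<omega>) \<omega> = 0"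
    and X_motion: "\<And>\<omega> n t. \<omega> \<in> space M \<Longrightarrow> T n \<omega> \<le> t \<Longrightarrow> t \<le> T (Suc n) \<omega> \<Longrightarrow>
      X t \<omega> = along_great_circle (X (T n \<omega>) \<omega>) (V n \<omega>) (c * (t - T n \<omega>))"

definition mean_cos_dist :: "'a measure \<Rightarrow> real^3 \<Rightarrow> (real \<Rightarrow> 'a \<Rightarrow> real^3) \<Rightarrow> real \<Rightarrow> real" where
  "mean_cos_dist M P0 X t = prob_space.expectation M (\<lambda>\<omega>. cos (sphere_dist P0 (X t \<omega>)))"

end

theory Submission
  imports Defs
begin

text \<open>Since every turn is orthogonal to the great circle through \<open>P0\<close>, the direction vectors are all
  orthogonal to \<open>P0\<close>. So between turns \<open>cos d(P0,X t)\<close> is the real part of a complex number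
  that rotates with angular velocity \<open>c\<close>, and an event replaces this number by its real part.
  Cut \<open>[0,t]\<close> into cells of length \<open>h\<close>, rotate by \<open>c h\<close> in the cells without an
  event and take the real part in the others: each cell with an event contributes an error of order
  \<open>h\<close>, so this walk converges pointwise to that number at time \<open>t\<close> as \<open>h\<close> tends to 0. By the independence of
  increments its mean is obtained by iterating one linear contraction
  \<open>z \<mapsto> p cis(c h) z + (1 - p) Re z\<close> with \<open>p = exp(-rate h)\<close>, which is a one-step scheme of
  local error \<open>O(h\<^sup>2)\<close> for the system \<open>e' = -c z, z' = c e - rate z\<close>. This system is the
  asserted equation for \<open>e\<close>; hence \<open>E\<close> agrees with its solution.\<close>

subsection \<open>Geometry of the unit sphere\<close>

text \<open>Every admissible arc length \<open>s\<close> satisfies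
  \<open>cos s = p \<bullet> q\<close>, so none is below \<open>arccos (p \<bullet> q)\<close>; this
  value is itself admissible, so the infimum is attained there.\<close>

lemma cos_sphere_dist:
  assumes p: "norm p = 1" and q: "norm q = 1"
  shows "cos (sphere_dist p q) = p \<bullet> q"
proof -
  define S where "S = {s. 0 \<le> s \<and> (\<exists>v. norm v = 1 \<and> v \<bullet> p = 0 \<and> along_great_circle p v s = q)}"
  define a where "a = arccos (p \<bullet> q)"
  have pp: "p \<bullet> p = 1" and qq: "q \<bullet> q = 1"
    using p q by (simp_all add: dot_square_norm)
  have "\<bar>p \<bullet> q\<bar> \<le> 1"
    using Cauchy_Schwarz_ineq2[of p q] p q by simp
  then have le: "-1 \<le> p \<bullet> q" "p \<bullet> q \<le> 1" by auto
  have cos_a: "cos a = p \<bullet> q" and a: "0 \<le> a" "a \<le> pi"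
    using le by (auto simp: a_def arccos_lbound arccos_ubound)
  have "a \<in> S"
  proof (cases "sin a = 0")
    case True
    \<comment> \<open>Here \<open>q\<close> is \<open>p\<close> or its antipode, and every tangent
      direction at \<open>p\<close> leads to it.\<close>
    obtain y where y: "y \<noteq> 0" "orthogonal p y"
      using orthogonal_to_vector_exists[of p] by auto
    have "(q - cos a *\<^sub>R p) \<bullet> (q - cos a *\<^sub>R p) = 1 - (cos a)\<^sup>2"
      by (simp add: inner_diff_left inner_diff_right pp qq cos_a inner_commute power2_eq_square)
    also have "\<dots> = 0" using True sin_cos_squared_add[of a] by simp
    finally have "q = cos a *\<^sub>R p" by simp
    then have "along_great_circle p (y /\<^sub>R norm y) a = q"
      using True by (simp add: along_great_circle_def)
    moreover have "norm (y /\<^sub>R norm y) = 1" "(y /\<^sub>R norm y) \<bullet> p = 0"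
      using y by (auto simp: orthogonal_def inner_commute)
    ultimately show ?thesis using a unfolding S_def by blast
  next
    case False
    \<comment> \<open>The component of \<open>q\<close> orthogonal to \<open>p\<close> has length
      \<open>sin a\<close>; normalising it gives the initial direction of the arc.\<close>
    define v where "v = (q - cos a *\<^sub>R p) /\<^sub>R sin a"
    have "(q - cos a *\<^sub>R p) \<bullet> (q - cos a *\<^sub>R p) = 1 - (cos a)\<^sup>2"
      by (simp add: inner_diff_left inner_diff_right pp qq cos_a inner_commute power2_eq_square)
    also have "\<dots> = (sin a)\<^sup>2" by (simp add: sin_squared_eq)
    finally have "v \<bullet> v = inverse (sin a) * (inverse (sin a) * (sin a)\<^sup>2)"
      by (simp add: v_def)
    also have "\<dots> = 1" using False by (simp add: power2_eq_square field_simps)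
    finally have "norm v = 1" by (simp add: norm_eq_1)
    moreover have "v \<bullet> p = 0"
      by (simp add: v_def inner_diff_left inner_diff_right pp cos_a inner_commute)
    moreover have "along_great_circle p v a = q"
      using False by (simp add: along_great_circle_def v_def)
    ultimately show ?thesis using a unfolding S_def by blast
  qed
  moreover have "a \<le> s" if "s \<in> S" for s
  proof (cases "s \<le> pi")
    case True
    from that obtain v where v: "0 \<le> s" "v \<bullet> p = 0" "along_great_circle p v s = q"
      unfolding S_def by auto
    have "p \<bullet> q = cos s"
      using v by (simp add: along_great_circle_def inner_add_right pp inner_commute flip: v(3))
    then show ?thesis using True v by (simp add: a_def arccos_cos)
  qed (use a in simp)
  ultimately have "Inf S = a" by (intro cInf_eq_minimum)
  then show ?thesis using cos_a by (simp add: sphere_dist_def S_def)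
qed

text \<open>In three dimensions the vectors orthogonal to both \<open>w\<close> and \<open>x\<close>
  form a line, spanned by their cross product. Hence \<open>v\<close> is a multiple of the nonzero
  vector \<open>u\<close>. Meant for \<open>w\<close>, \<open>u\<close> the normals of the new and
  the reference circle, \<open>x\<close> the turning point and \<open>v\<close> the new
  direction.\<close>

lemma orthogonal_to_orthonormal_pair:
  fixes w x u v p :: "real^3"
  assumes "norm w = 1" "norm x = 1" "w \<bullet> x = 0" "u \<noteq> 0"
    and "u \<bullet> w = 0" "u \<bullet> x = 0" "v \<bullet> w = 0" "v \<bullet> x = 0" "p \<bullet> u = 0"
  shows "p \<bullet> v = 0"
proof -
  include cross3_syntax
  define k where "k = w \<times> x"
  have "k \<noteq> 0"
    using norm_and_cross_eq_0[of w x] assms by (auto simp: k_def)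
  have "\<exists>r. y = r *\<^sub>R k" if "y \<bullet> w = 0" "y \<bullet> x = 0" for y
  proof -
    have "k \<times> y = 0"
      using that Lagrange[of y w x] cross_skew[of k y] by (simp add: k_def inner_commute)
    then have "collinear {0, k, y}" by (simp add: cross_eq_0)
    then show ?thesis using \<open>k \<noteq> 0\<close> by (auto simp: collinear_lemma intro: exI[of _ 0])
  qed
  then obtain r s where "u = r *\<^sub>R k" "v = s *\<^sub>R k" using assms by metis
  then show ?thesis using assms by auto
qed

subsection \<open>The mean step as a one-step scheme\<close>

lemma second_order_taylor_bound:
  fixes g g' g'' :: "real \<Rightarrow> real"
  assumes g: "\<And>x. (g has_real_derivative g' x) (at x)"
    and g': "\<And>x. (g' has_real_derivative g'' x) (at x)"
    and bound: "\<And>x. a \<le> x \<Longrightarrow> x \<le> a + h \<Longrightarrow> \<bar>g'' x\<bar> \<le> K" and h: "0 \<le> h"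
  shows "\<bar>g (a + h) - g a - h * g' a\<bar> \<le> K * h\<^sup>2"
proof (cases "h = 0")
  case False
  define d where "d = (\<lambda>m::nat. if m = 0 then g else if m = 1 then g' else g'')"
  have "\<exists>t>a. t < a + h \<and> g (a + h) =
      (\<Sum>m<2. d m a / fact m * (a + h - a) ^ m) + d 2 t / fact 2 * (a + h - a) ^ 2"
    using g g' h False by (intro Taylor_up[where a = a]) (auto simp: d_def less_2_cases_iff)
  then obtain t where t: "a < t" "t < a + h" "g (a + h) - g a - h * g' a = g'' t / 2 * h\<^sup>2"
    by (auto simp: d_def numeral_2_eq_2)
  have "\<bar>g'' t / 2\<bar> \<le> K" using bound[of t] t by auto
  then show ?thesis unfolding t(3) abs_mult by (intro mult_mono) auto
qed simp

text \<open>The mean of the next value of the walk, given the present value \<open>z\<close>, when a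
  cell has no event with probability \<open>p\<close>. It is real-linear but not complex-linear, so
  its iterates are not powers of one complex number.\<close>

definition turn_step :: "real \<Rightarrow> real \<Rightarrow> complex \<Rightarrow> complex" where
  "turn_step p \<theta> z = of_real p * (cis \<theta> * z) + of_real ((1 - p) * Re z)"

text \<open>A convex combination of a rotation and the projection onto the real axis, neither of
  which increases the norm. This is the stability of the scheme: earlier errors are not
  amplified.\<close>

lemma turn_step_contraction:
  assumes "0 \<le> p" "p \<le> 1"
  shows "norm (turn_step p \<theta> x - turn_step p \<theta> y) \<le> norm (x - y)"
proof -
  have "turn_step p \<theta> x - turn_step p \<theta> y =
      of_real p * (cis \<theta> * (x - y)) + of_real ((1 - p) * Re (x - y))"
    by (simp add: turn_step_def algebra_simps)
  also have "norm \<dots> \<le> p * norm (x - y) + (1 - p) * \<bar>Re (x - y)\<bar>"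
    using assms by (intro norm_triangle_le add_mono) (auto simp: norm_mult abs_mult simp del: of_real_mult of_real_diff minus_complex.simps)
  also have "\<dots> \<le> p * norm (x - y) + (1 - p) * norm (x - y)"
    using assms by (intro add_left_mono mult_left_mono abs_Re_le_cmod) auto
  finally show ?thesis by (simp add: algebra_simps)
qed

lemma abs_sin_minus_le:
  fixes x :: real
  assumes "0 \<le> x"
  shows "\<bar>x - sin x\<bar> \<le> x\<^sup>2"
proof -
  have "\<bar>sin (0 + x) - sin 0 - x * cos 0\<bar> \<le> 1 * x\<^sup>2"
    by (rule second_order_taylor_bound[where g'' = "\<lambda>x. - sin x"])
       (use assms in \<open>auto intro!: derivative_eq_intros\<close>)
  then show ?thesis by (simp add: abs_minus_commute)
qed

lemma abs_one_minus_cos_le: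
  fixes x :: real
  assumes "0 \<le> x"
  shows "\<bar>1 - cos x\<bar> \<le> x\<^sup>2"
proof -
  have "\<bar>cos (0 + x) - cos 0 - x * (- sin 0)\<bar> \<le> 1 * x\<^sup>2"
    by (rule second_order_taylor_bound[where g'' = "\<lambda>x. - cos x"])
       (use assms in \<open>auto intro!: derivative_eq_intros\<close>)
  then show ?thesis by simp
qed

lemma abs_exp_minus_le:
  fixes x :: real
  assumes "0 \<le> x"
  shows "\<bar>exp (- x) - (1 - x)\<bar> \<le> x\<^sup>2"
proof -
  have "\<bar>exp (- (0 + x)) - exp (- 0) - x * (- exp (- 0))\<bar> \<le> 1 * x\<^sup>2"
    by (rule second_order_taylor_bound[where g'' = "\<lambda>x. exp (- x)"])
       (use assms in \<open>auto intro!: derivative_eq_intros\<close>)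
  then show ?thesis by (simp add: algebra_simps)
qed

text \<open>Consistency of the scheme. Both the exact flow and \<open>turn_step\<close> agree up to
  order \<open>h^2\<close> with the Euler step of the system, since \<open>p * sin \<theta>\<close>
  is close to \<open>c * h\<close>, \<open>p * cos \<theta>\<close> to \<open>1 - \<mu> * h\<close>,
  and \<open>p * cos \<theta> + 1 - p\<close> to 1.\<close>

lemma turn_step_approx:
  fixes e z :: "real \<Rightarrow> real" and \<mu> c t :: real
  assumes e: "\<And>s. (e has_real_derivative - c * z s) (at s)"
    and z: "\<And>s. (z has_real_derivative c * e s - \<mu> * z s) (at s)"
    and pos: "0 < \<mu>" "0 < c"
  shows "\<exists>K\<ge>0. \<forall>s h. 0 \<le> s \<longrightarrow> 0 \<le> h \<longrightarrow> s + h \<le> t \<longrightarrow>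
     norm (Complex (e (s + h)) (z (s + h)) -
           turn_step (exp (- (\<mu> * h))) (c * h) (Complex (e s) (z s))) \<le> K * h\<^sup>2"
proof -
  have "continuous_on {0..t} e" "continuous_on {0..t} z"
    by (rule DERIV_continuous_on, rule has_field_derivative_at_within, rule e z)+
  then have "bounded (e ` {0..t})" "bounded (z ` {0..t})"
    by (auto intro!: compact_imp_bounded compact_continuous_image)
  then obtain A1 A2 where "\<forall>x\<in>{0..t}. \<bar>e x\<bar> \<le> A1" "\<forall>x\<in>{0..t}. \<bar>z x\<bar> \<le> A2"
    unfolding bounded_iff by auto
  then obtain A where A: "0 \<le> A" "\<And>x. 0 \<le> x \<Longrightarrow> x \<le> t \<Longrightarrow> \<bar>e x\<bar> \<le> A \<and> \<bar>z x\<bar> \<le> A"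
    by (intro that[of "max 0 (max A1 A2)"]) (auto simp: le_max_iff_disj)
  \<comment> \<open>\<open>K1\<close> and \<open>K2\<close> bound the second derivatives of
    \<open>e\<close> and \<open>z\<close>, computed from the system. The other summands of
    \<open>K\<close> come from the coefficient errors \<open>C\<close>, \<open>S\<close> (real part)
    and \<open>S\<close>, \<open>D\<close> (imaginary part) below.\<close>
  define K1 where "K1 = c * ((c + \<mu>) * A)"
  define K2 where "K2 = (c * c + \<mu> * (c + \<mu>)) * A"
  define K where "K = K1 + K2 + A * (c\<^sup>2 + (c\<^sup>2 + \<mu> * c)) + A * ((c\<^sup>2 + \<mu> * c) + (\<mu>\<^sup>2 + c\<^sup>2))"
  have "norm (Complex (e (s + h)) (z (s + h)) -
           turn_step (exp (- (\<mu> * h))) (c * h) (Complex (e s) (z s))) \<le> K * h\<^sup>2"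
    if sh: "0 \<le> s" "0 \<le> h" "s + h \<le> t" for s h
  proof -
    define p where "p = exp (- (\<mu> * h))"
    define \<theta> where "\<theta> = c * h"
    have p: "0 \<le> p" "p \<le> 1" "0 \<le> \<theta>" using pos sh by (auto simp: p_def \<theta>_def)
    have z'_bound: "\<bar>c * e x - \<mu> * z x\<bar> \<le> (c + \<mu>) * A" if "s \<le> x" "x \<le> s + h" for x
    proof -
      have "\<bar>c * e x - \<mu> * z x\<bar> \<le> c * \<bar>e x\<bar> + \<mu> * \<bar>z x\<bar>"
        using pos abs_triangle_ineq4[of "c * e x" "\<mu> * z x"] by (simp add: abs_mult)
      also have "\<dots> \<le> c * A + \<mu> * A"
        using A(2)[of x] that sh pos by (intro add_mono mult_left_mono) auto
      finally show ?thesis by (simp add: algebra_simps)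
    qed
    have E1: "\<bar>e (s + h) - e s - h * (- c * z s)\<bar> \<le> K1 * h\<^sup>2"
    proof (rule second_order_taylor_bound)
      show "((\<lambda>x. - c * z x) has_real_derivative - c * (c * e x - \<mu> * z x)) (at x)" for x
        by (auto intro!: derivative_eq_intros z)
      show "\<bar>- c * (c * e x - \<mu> * z x)\<bar> \<le> K1" if "s \<le> x" "x \<le> s + h" for x
        using mult_left_mono[OF z'_bound[OF that], of c] pos
        by (simp add: abs_mult K1_def)
    qed (use sh e in auto)
    have E2: "\<bar>z (s + h) - z s - h * (c * e s - \<mu> * z s)\<bar> \<le> K2 * h\<^sup>2"
    proof (rule second_order_taylor_bound)
      show "((\<lambda>x. c * e x - \<mu> * z x) has_real_derivative
              c * (- c * z x) - \<mu> * (c * e x - \<mu> * z x)) (at x)" for x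
        by (auto intro!: derivative_eq_intros e z)
      show "\<bar>c * (- c * z x) - \<mu> * (c * e x - \<mu> * z x)\<bar> \<le> K2" if "s \<le> x" "x \<le> s + h" for x
      proof -
        have "\<bar>c * (- c * z x) - \<mu> * (c * e x - \<mu> * z x)\<bar>
            \<le> c * c * \<bar>z x\<bar> + \<mu> * \<bar>c * e x - \<mu> * z x\<bar>"
          using pos abs_triangle_ineq4[of "c * (- c * z x)" "\<mu> * (c * e x - \<mu> * z x)"]
          by (simp add: abs_mult)
        also have "\<dots> \<le> c * c * A + \<mu> * ((c + \<mu>) * A)"
          using A(2)[of x] that sh pos z'_bound[OF that] by (intro add_mono mult_left_mono) auto
        finally show ?thesis by (simp add: K2_def algebra_simps)
      qed
    qed (use sh z in auto)
    have one_p: "\<bar>1 - p\<bar> \<le> \<mu> * h"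
      using p exp_ge_add_one_self[of "- (\<mu> * h)"] by (simp add: p_def)
    have S: "\<bar>\<theta> - p * sin \<theta>\<bar> \<le> (c\<^sup>2 + \<mu> * c) * h\<^sup>2"
    proof -
      have "\<bar>\<theta> - p * sin \<theta>\<bar> \<le> \<bar>\<theta> - sin \<theta>\<bar> + \<bar>1 - p\<bar> * \<bar>sin \<theta>\<bar>"
        unfolding abs_mult[symmetric] by (intro order_trans[OF _ abs_triangle_ineq]) (simp add: algebra_simps)
      also have "\<dots> \<le> \<theta>\<^sup>2 + (\<mu> * h) * \<theta>"
        using abs_sin_minus_le[OF p(3)] one_p p pos sh abs_sin_x_le_abs_x[of \<theta>]
        by (intro add_mono mult_mono) auto
      finally show ?thesis by (simp add: \<theta>_def algebra_simps power2_eq_square)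
    qed
    have C: "\<bar>p * (1 - cos \<theta>)\<bar> \<le> c\<^sup>2 * h\<^sup>2"
      using mult_mono[of "\<bar>p\<bar>" 1 "\<bar>1 - cos \<theta>\<bar>" "\<theta>\<^sup>2"] p abs_one_minus_cos_le[OF p(3)]
      by (simp add: abs_mult \<theta>_def power_mult_distrib)
    have D: "\<bar>(1 - \<mu> * h) - p * cos \<theta>\<bar> \<le> (\<mu>\<^sup>2 + c\<^sup>2) * h\<^sup>2"
    proof -
      have "\<bar>(1 - \<mu> * h) - p * cos \<theta>\<bar> \<le> \<bar>p - (1 - \<mu> * h)\<bar> + \<bar>p * (1 - cos \<theta>)\<bar>"
        using abs_triangle_ineq4[of "p * (1 - cos \<theta>)" "p - (1 - \<mu> * h)"] by (simp add: algebra_simps)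
      also have "\<dots> \<le> (\<mu> * h)\<^sup>2 + c\<^sup>2 * h\<^sup>2"
        using C abs_exp_minus_le[of "\<mu> * h"] pos sh by (intro add_mono) (auto simp: p_def)
      finally show ?thesis by (simp add: algebra_simps power_mult_distrib)
    qed
    have As: "\<bar>e s\<bar> \<le> A" "\<bar>z s\<bar> \<le> A" using A(2)[of s] sh by auto
    have bnd: "\<bar>x * e s\<bar> \<le> A * (B * h\<^sup>2)" "\<bar>x * z s\<bar> \<le> A * (B * h\<^sup>2)"
      if "\<bar>x\<bar> \<le> B * h\<^sup>2" for x B
      using mult_mono[OF As(1) that] mult_mono[OF As(2) that] A(1)
      by (simp_all add: abs_mult mult.commute)
    let ?d = "Complex (e (s + h)) (z (s + h)) - turn_step p \<theta> (Complex (e s) (z s))"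
    have "Re ?d = (e (s + h) - e s - h * (- c * z s)) + p * (1 - cos \<theta>) * e s - (\<theta> - p * sin \<theta>) * z s"
      by (simp add: turn_step_def algebra_simps \<theta>_def)
    then have R: "\<bar>Re ?d\<bar> \<le> K1 * h\<^sup>2 + A * (c\<^sup>2 * h\<^sup>2) + A * ((c\<^sup>2 + \<mu> * c) * h\<^sup>2)"
      using E1 bnd(1)[OF C] bnd(2)[OF S] by linarith
    have "Im ?d = (z (s + h) - z s - h * (c * e s - \<mu> * z s)) + (\<theta> - p * sin \<theta>) * e s
        + ((1 - \<mu> * h) - p * cos \<theta>) * z s"
      by (simp add: turn_step_def algebra_simps \<theta>_def)
    then have I: "\<bar>Im ?d\<bar> \<le> K2 * h\<^sup>2 + A * ((c\<^sup>2 + \<mu> * c) * h\<^sup>2) + A * ((\<mu>\<^sup>2 + c\<^sup>2) * h\<^sup>2)"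
      using E2 bnd(1)[OF S] bnd(2)[OF D] by linarith
    have "norm ?d \<le> \<bar>Re ?d\<bar> + \<bar>Im ?d\<bar>" by (rule cmod_le)
    also have "\<dots> \<le> K * h\<^sup>2"
      using add_mono[OF R I] by (simp add: K_def algebra_simps)
    finally show ?thesis unfolding p_def \<theta>_def .
  qed
  moreover have "0 \<le> K" using A(1) pos by (simp add: K_def K1_def K2_def)
  ultimately show ?thesis by blast
qed

lemma LIMSEQ_from_inverse_bound:
  fixes f :: "nat \<Rightarrow> real"
  assumes "\<And>m. \<bar>f m - l\<bar> \<le> C / Suc m"
  shows "f \<longlonglongrightarrow> l"
proof (rule LIM_zero_cancel, rule Lim_null_comparison)
  show "\<forall>\<^sub>F m in sequentially. norm (f m - l) \<le> C / Suc m" using assms by simp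
  show "(\<lambda>m. C / Suc m) \<longlonglongrightarrow> 0"
    using LIMSEQ_Suc[OF lim_const_over_n[of C]] by simp
qed

text \<open>Consistency and stability give convergence: \<open>m + 1\<close> local errors of size
  \<open>K * (t / (m + 1))^2\<close> add up to \<open>K * t^2 / (m + 1)\<close>.\<close>

lemma turn_step_iterate_tendsto:
  fixes e z :: "real \<Rightarrow> real" and \<mu> c t :: real
  assumes e: "\<And>s. (e has_real_derivative - c * z s) (at s)"
    and z: "\<And>s. (z has_real_derivative c * e s - \<mu> * z s) (at s)"
    and pos: "0 < \<mu>" "0 < c" and init: "e 0 = 1" "z 0 = 0" and t: "0 \<le> t"
  shows "(\<lambda>m. Re ((turn_step (exp (- (\<mu> * (t / Suc m)))) (c * (t / Suc m)) ^^ Suc m) 1)) \<longlonglongrightarrow> e t"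
proof -
  define w where "w = (\<lambda>s. Complex (e s) (z s))"
  obtain K where K: "0 \<le> K" "\<And>s h. 0 \<le> s \<Longrightarrow> 0 \<le> h \<Longrightarrow> s + h \<le> t \<Longrightarrow>
     norm (w (s + h) - turn_step (exp (- (\<mu> * h))) (c * h) (w s)) \<le> K * h\<^sup>2"
    using turn_step_approx[OF e z pos, of t] unfolding w_def by blast
  have step: "norm (w (real j * h) - (turn_step (exp (- (\<mu> * h))) (c * h) ^^ j) 1) \<le> real j * (K * h\<^sup>2)"
    if h: "0 \<le> h" and j: "real j * h \<le> t" for h j
    using j
  proof (induction j)
    case 0
    show ?case using init by (simp add: w_def complex_eq_iff)
  next
    case (Suc j)
    let ?B = "turn_step (exp (- (\<mu> * h))) (c * h)"
    have le: "real j * h + h \<le> t" using Suc.prems by (simp add: algebra_simps)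
    \<comment> \<open>The new error splits into the local error of this step and the previous error
      carried through the contraction.\<close>
    have "norm (w (real j * h + h) - ?B ((?B ^^ j) 1))
        \<le> norm (w (real j * h + h) - ?B (w (real j * h))) + norm (?B (w (real j * h)) - ?B ((?B ^^ j) 1))"
      by (rule order_trans[OF _ norm_triangle_ineq]) simp
    also have "\<dots> \<le> K * h\<^sup>2 + real j * (K * h\<^sup>2)"
      using K(2)[of "real j * h" h] h le Suc.IH pos
      by (intro add_mono order_trans[OF turn_step_contraction]) auto
    finally show ?case by (simp add: algebra_simps)
  qed
  have "\<bar>Re ((turn_step (exp (- (\<mu> * (t / Suc m)))) (c * (t / Suc m)) ^^ Suc m) 1) - e t\<bar>
      \<le> K * t\<^sup>2 / Suc m" for m
  proof -
    have "norm (w t - (turn_step (exp (- (\<mu> * (t / Suc m)))) (c * (t / Suc m)) ^^ Suc m) 1)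
        \<le> real (Suc m) * (K * (t / Suc m)\<^sup>2)"
      using step[of "t / Suc m" "Suc m"] t by (simp del: funpow.simps of_nat_Suc)
    also have "\<dots> = K * t\<^sup>2 / Suc m"
      by (simp add: power2_eq_square field_simps del: of_nat_Suc)
    finally show ?thesis
      using abs_Re_le_cmod[of "w t - (turn_step (exp (- (\<mu> * (t / Suc m)))) (c * (t / Suc m)) ^^ Suc m) 1"]
      by (simp add: w_def abs_minus_commute del: funpow.simps of_nat_Suc)
  qed
  then show ?thesis by (rule LIMSEQ_from_inverse_bound)
qed

subsection \<open>The walk on a time grid\<close>

text \<open>\<open>d j\<close> is the number of events in the \<open>j\<close>-th cell of the grid. The turn in a cell
  containing an event is made at the left end of the cell, and there is no rotation in that cell.\<close>

primrec grid_walk :: "real \<Rightarrow> (nat \<Rightarrow> nat) \<Rightarrow> nat \<Rightarrow> complex" where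
  "grid_walk \<theta> d 0 = 1"
| "grid_walk \<theta> d (Suc j) =
     (if d j = 0 then cis \<theta> * grid_walk \<theta> d j else of_real (Re (grid_walk \<theta> d j)))"

text \<open>Lets the walk after \<open>j\<close> cells be read as a function of the counts
  restricted to \<open>{..<j}\<close>, the form in which independence is applied.\<close>

lemma grid_walk_cong: "(\<And>i. i < j \<Longrightarrow> d i = d' i) \<Longrightarrow> grid_walk \<theta> d j = grid_walk \<theta> d' j"
  by (induction j) auto

lemma norm_grid_walk_le: "norm (grid_walk \<theta> d j) \<le> 1"
proof (induction j)
  case (Suc j)
  then show ?case using abs_Re_le_cmod[of "grid_walk \<theta> d j"] by (auto simp: norm_mult)
qed simp

text \<open>A chord of the unit circle is no longer than its arc.\<close>

lemma norm_one_minus_cis_le: "norm (1 - cis \<theta>) \<le> \<bar>\<theta>\<bar>"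
proof -
  have "norm (1 - cis \<theta>) = 2 * \<bar>sin (\<theta> / 2)\<bar>"
    using dist_exp_i_1[of \<theta>] by (simp add: norm_minus_commute cis_conv_exp)
  also have "\<dots> \<le> \<bar>\<theta>\<bar>" using abs_sin_x_le_abs_x[of "\<theta> / 2"] by simp
  finally show ?thesis .
qed

section \<open>Mean of the grid walk by independence of increments\<close>

context homogeneous_poisson_process
begin

lemma prob_no_event:
  assumes "0 \<le> s" "s < t"
  shows "prob {\<omega> \<in> space M. N t \<omega> - N s \<omega> = 0} = exp (- (rate * (t - s)))"
proof -
  have meas: "(\<lambda>\<omega>. N t \<omega> - N s \<omega>) \<in> measurable M (count_space UNIV)"
    using N_measurable[of t] N_measurable[of s] assms by simp
  have "prob {\<omega> \<in> space M. N t \<omega> - N s \<omega> = 0} =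
      measure (distr M (count_space UNIV) (\<lambda>\<omega>. N t \<omega> - N s \<omega>)) {0}"
    using meas by (subst measure_distr) (auto intro!: arg_cong[where f = prob])
  also have "\<dots> = pmf (poisson_pmf (rate * (t - s))) 0"
    using assms by (simp add: poisson_increments measure_pmf_single)
  also have "\<dots> = exp (- (rate * (t - s)))"
    using assms rate_pos by simp
  finally show ?thesis .
qed

text \<open>The first \<open>j\<close> increments determine the walk so far and are independent of
  the next one, so taking means in the recursion turns each step into \<open>turn_step\<close>.
  Measurability is carried through the same induction.\<close>

lemma expectation_grid_walk:
  assumes h: "0 < h"
  defines "d \<equiv> \<lambda>\<omega> i. N (real (Suc i) * h) \<omega> - N (real i * h) \<omega>"
  shows "(\<lambda>\<omega>. grid_walk \<theta> (d \<omega>) j) \<in> borel_measurable M \<and>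
    (\<integral>\<omega>. grid_walk \<theta> (d \<omega>) j \<partial>M) = (turn_step (exp (- (rate * h))) \<theta> ^^ j) 1"
proof (induction j)
  case 0
  show ?case by (simp add: prob_space)
next
  case (Suc j)
  define p where "p = exp (- (rate * h))"
  define G where "G = (\<lambda>\<omega>. grid_walk \<theta> (d \<omega>) j)"
  define I where "I = (\<lambda>\<omega>. of_bool (d \<omega> j = 0) :: complex)"
  have G_meas: "G \<in> borel_measurable M" using Suc by (simp add: G_def)
  have "indep_vars (\<lambda>_. count_space UNIV) (\<lambda>i \<omega>. d \<omega> i) {..<Suc j}"
    unfolding d_def using h
    by (intro indep_increments[of "\<lambda>i. real i * h"]) (auto intro!: strict_monoI)
  from indep_var_restrict[OF this, of "{..<j}" "{j}"]
  have ind: "indep_var (PiM {..<j} (\<lambda>_. count_space UNIV)) (\<lambda>\<omega>. restrict (\<lambda>i. d \<omega> i) {..<j})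
      (PiM {j} (\<lambda>_. count_space UNIV)) (\<lambda>\<omega>. restrict (\<lambda>i. d \<omega> i) {j})"
    by auto
  \<comment> \<open>A finite product of these count spaces is again a count space, so both maps are
    measurable at once.\<close>
  have "indep_var borel ((\<lambda>x. grid_walk \<theta> x j) \<circ> (\<lambda>\<omega>. restrict (\<lambda>i. d \<omega> i) {..<j}))
      borel ((\<lambda>x. of_bool (x j = 0) :: complex) \<circ> (\<lambda>\<omega>. restrict (\<lambda>i. d \<omega> i) {j}))"
    by (intro indep_var_compose[OF ind]) (auto simp: count_space_PiM_finite)
  moreover have "(\<lambda>x. grid_walk \<theta> x j) \<circ> (\<lambda>\<omega>. restrict (\<lambda>i. d \<omega> i) {..<j}) = G"
    by (auto simp: G_def fun_eq_iff intro!: grid_walk_cong)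
  moreover have "(\<lambda>x. of_bool (x j = 0) :: complex) \<circ> (\<lambda>\<omega>. restrict (\<lambda>i. d \<omega> i) {j}) = I"
    by (auto simp: I_def fun_eq_iff)
  ultimately have GI: "indep_var borel G borel I" by simp
  have I_meas: "I \<in> borel_measurable M" using indep_var_rv2[OF GI] .
  have int: "integrable M G" "integrable M I"
    using G_meas I_meas norm_grid_walk_le
    by (auto intro!: integrable_const_bound[where B = 1] simp: G_def I_def)
  have int_GI: "integrable M (\<lambda>\<omega>. G \<omega> * I \<omega>)"
    by (rule indep_var_integrable[OF GI int])
  have "(\<integral>\<omega>. I \<omega> \<partial>M) = (\<integral>\<omega>. of_real (indicator {\<omega> \<in> space M. d \<omega> j = 0} \<omega>) \<partial>M)"
    by (intro Bochner_Integration.integral_cong) (auto simp: I_def)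
  also have "\<dots> = of_real (prob {\<omega> \<in> space M. d \<omega> j = 0})"
    by (simp add: Int_def conj_commute)
  also have "\<dots> = of_real p"
    using prob_no_event[of "real j * h" "real (Suc j) * h"] h
    by (simp add: d_def p_def algebra_simps)
  finally have EI: "(\<integral>\<omega>. I \<omega> \<partial>M) = of_real p" .
  have EGI: "(\<integral>\<omega>. G \<omega> * I \<omega> \<partial>M) = (\<integral>\<omega>. G \<omega> \<partial>M) * of_real p"
    unfolding EI[symmetric] by (rule indep_var_lebesgue_integral[OF GI int])
  \<comment> \<open>Removes the case distinction: the recursion becomes real-linear in
    \<open>G\<close> and \<open>G * I\<close>, and independence factors the mean of the
    product.\<close>
  have eq: "grid_walk \<theta> (d \<omega>) (Suc j) =
      cis \<theta> * (G \<omega> * I \<omega>) + of_real (Re (G \<omega>)) - of_real (Re (G \<omega> * I \<omega>))" for \<omega>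
    by (simp add: G_def I_def)
  have "(\<lambda>\<omega>. grid_walk \<theta> (d \<omega>) (Suc j)) \<in> borel_measurable M"
    unfolding eq using G_meas I_meas by measurable
  moreover have "(\<integral>\<omega>. grid_walk \<theta> (d \<omega>) (Suc j) \<partial>M) =
      cis \<theta> * (\<integral>\<omega>. G \<omega> * I \<omega> \<partial>M) + of_real (Re (\<integral>\<omega>. G \<omega> \<partial>M)) - of_real (Re (\<integral>\<omega>. G \<omega> * I \<omega> \<partial>M))"
    unfolding eq using int int_GI by (simp add: integral_Re integrable_Re del: times_complex.sel)
  moreover have "\<dots> = turn_step p \<theta> (\<integral>\<omega>. G \<omega> \<partial>M)"
    unfolding EGI turn_step_def by (simp add: complex_eq_iff algebra_simps)
  ultimately show ?case using Suc by (simp add: G_def p_def)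
qed

end

section \<open>Paths of the motion and their distance from the grid walk\<close>

context orthogonal_sphere_motion
begin

lemma norm_P0: "norm P0 = 1"
  using P0_equator by (simp add: equator_def)

lemma norm_turning_point:
  assumes "\<omega> \<in> space M"
  shows "norm (X (T n \<omega>) \<omega>) = 1"
proof (cases n)
  case 0
  then show ?thesis using assms T_0 X_0 norm_P0 by simp
next
  case (Suc k)
  then show ?thesis using C_turn[OF assms, of n]
    by (auto simp: orthogonal_great_circles_def great_circle_def)
qed

text \<open>Initially the direction is tangent at \<open>P0\<close> itself. After a turn,
  \<open>V n\<close> and the normal \<open>u\<close> of the reference circle are both orthogonal to
  the turning point and to the normal \<open>w\<close> of the new circle, hence parallel; and
  \<open>P0\<close> lies on the reference circle.\<close>

lemma direction_orthogonal_P0: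
  assumes \<omega>: "\<omega> \<in> space M"
  shows "P0 \<bullet> V n \<omega> = 0"
proof (cases n)
  case 0
  then show ?thesis using V_direction[OF \<omega>, of 0] T_0[OF \<omega>] X_0[OF \<omega>] by (simp add: inner_commute)
next
  case (Suc k)
  obtain u w where uw: "X (T n \<omega>) \<omega> \<in> great_circle w" "P0 \<in> great_circle u"
    "X (T n \<omega>) \<omega> \<in> great_circle u" "norm u = 1" "norm w = 1" "C n \<omega> = great_circle w" "u \<bullet> w = 0"
    using C_turn[OF \<omega>, of n] Suc by (auto simp: orthogonal_great_circles_def)
  show ?thesis
    by (rule orthogonal_to_orthonormal_pair[of w "X (T n \<omega>) \<omega>" u])
       (use uw V_direction[OF \<omega>, of n] in \<open>auto simp: great_circle_def inner_commute\<close>)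
qed

lemma norm_direction: "\<omega> \<in> space M \<Longrightarrow> norm (V n \<omega>) = 1"
  using V_direction[of \<omega> n] C_turn[of \<omega> n] C_0[of \<omega>]
  by (cases n) (auto simp: orthogonal_great_circles_def great_circle_def equator_def)

text \<open>The spherical Pythagorean relation for one arc: the sine term of the motion points along
  \<open>V n\<close>, which is orthogonal to \<open>P0\<close>.\<close>

lemma position_between_turns:
  assumes \<omega>: "\<omega> \<in> space M" and t: "T n \<omega> \<le> t" "t \<le> T (Suc n) \<omega>"
  shows "P0 \<bullet> X t \<omega> = (P0 \<bullet> X (T n \<omega>) \<omega>) * cos (c * (t - T n \<omega>))"
    and "norm (X t \<omega>) = 1"
proof -
  note eq = X_motion[OF \<omega> t, unfolded along_great_circle_def]
  show "P0 \<bullet> X t \<omega> = (P0 \<bullet> X (T n \<omega>) \<omega>) * cos (c * (t - T n \<omega>))"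
    using direction_orthogonal_P0[OF \<omega>, of n] by (simp add: eq inner_add_right)
  have "X (T n \<omega>) \<omega> \<bullet> X (T n \<omega>) \<omega> = 1" "V n \<omega> \<bullet> V n \<omega> = 1" "V n \<omega> \<bullet> X (T n \<omega>) \<omega> = 0"
    using norm_turning_point[OF \<omega>, of n] norm_direction[OF \<omega>, of n] V_direction[OF \<omega>, of n]
    by (auto simp: norm_eq_1)
  then have "X t \<omega> \<bullet> X t \<omega> = 1"
    by (simp add: eq inner_add_left inner_add_right inner_commute flip: power2_eq_square)
  then show "norm (X t \<omega>) = 1" by (simp add: norm_eq_1)
qed

text \<open>The index 0 with \<open>T 0 = 0\<close> is left out of the count, so \<open>N t\<close>
  is exactly the largest index \<open>n\<close> with \<open>T n \<le> t\<close>.\<close>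

lemma turning_times_N:
  assumes \<omega>: "\<omega> \<in> space M" and t: "0 \<le> t"
  shows "T (N t \<omega>) \<omega> \<le> t" "t < T (Suc (N t \<omega>)) \<omega>"
proof -
  let ?A = "{n. T n \<omega> \<le> t}"
  define m where "m = Max ?A"
  have fin: "finite ?A" and ne: "0 \<in> ?A" using T_finite[OF \<omega>] T_0[OF \<omega>] t by auto
  have mono: "T i \<omega> \<le> T k \<omega> \<longleftrightarrow> i \<le> k" for i k
    using T_strict_mono[OF \<omega>] by (rule strict_mono_less_eq)
  have m: "T m \<omega> \<le> t" using Max_in[OF fin] ne by (auto simp: m_def)
  have "?A = {..m}"
    using Max_ge[OF fin] m mono by (auto simp: m_def intro: order_trans[OF iffD2[OF mono]])
  then have "{n. 1 \<le> n \<and> T n \<omega> \<le> t} = {1..m}" by (auto simp: set_eq_iff)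
  then have "N t \<omega> = m" using N_counts[OF \<omega> t] by simp
  moreover have "t < T (Suc m) \<omega>" using \<open>?A = {..m}\<close> by (auto simp: set_eq_iff not_le[symmetric])
  ultimately show "T (N t \<omega>) \<omega> \<le> t" "t < T (Suc (N t \<omega>)) \<omega>" using m by auto
qed

text \<open>Between turns the inner product is a cosine of angular speed \<open>c\<close> with
  amplitude at most 1. The bounds on successive intervals are chained through the turning
  times.\<close>

lemma P0_inner_lipschitz:
  assumes \<omega>: "\<omega> \<in> space M" and s: "0 \<le> s" "s \<le> t"
  shows "\<bar>P0 \<bullet> X t \<omega> - P0 \<bullet> X s \<omega>\<bar> \<le> c * (t - s)"
proof -
  have amp: "\<bar>P0 \<bullet> X (T n \<omega>) \<omega>\<bar> \<le> 1" for n
    using Cauchy_Schwarz_ineq2[of P0 "X (T n \<omega>) \<omega>"] norm_P0 norm_turning_point[OF \<omega>] by simp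
  have cos_lip: "\<bar>cos x - cos y\<bar> \<le> \<bar>x - y\<bar>" for x y :: real
  proof -
    have "\<bar>cos x - cos y\<bar> = \<bar>Re (cis y * (1 - cis (x - y)))\<bar>"
      by (simp add: right_diff_distrib cis_mult)
    also have "\<dots> \<le> norm (cis y * (1 - cis (x - y)))" by (rule abs_Re_le_cmod)
    also have "\<dots> \<le> \<bar>x - y\<bar>" using norm_one_minus_cis_le by (simp add: norm_mult)
    finally show ?thesis .
  qed
  have within: "\<bar>P0 \<bullet> X t \<omega> - P0 \<bullet> X s \<omega>\<bar> \<le> c * (t - s)"
    if "T n \<omega> \<le> s" "s \<le> t" "t \<le> T (Suc n) \<omega>" for n s t
  proof -
    have "P0 \<bullet> X t \<omega> - P0 \<bullet> X s \<omega> =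
        (P0 \<bullet> X (T n \<omega>) \<omega>) * (cos (c * (t - T n \<omega>)) - cos (c * (s - T n \<omega>)))"
      using that position_between_turns(1)[OF \<omega>, of n t] position_between_turns(1)[OF \<omega>, of n s]
      by (simp only: right_diff_distrib)
    also have "\<bar>\<dots>\<bar> \<le> 1 * \<bar>c * (t - T n \<omega>) - c * (s - T n \<omega>)\<bar>"
      unfolding abs_mult by (intro mult_mono amp cos_lip) auto
    also have "c * (t - T n \<omega>) - c * (s - T n \<omega>) = c * (t - s)" by (simp add: algebra_simps)
    also have "1 * \<bar>\<dots>\<bar> = c * (t - s)" using that c_pos by simp
    finally show ?thesis .
  qed
  \<comment> \<open>Induction on the index of the interval containing \<open>t\<close>, with
    \<open>t\<close> general so that the hypothesis applies at the turning time
    \<open>T (Suc n)\<close>.\<close>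
  have "\<bar>P0 \<bullet> X t \<omega> - P0 \<bullet> X s \<omega>\<bar> \<le> c * (t - s)"
    if "T n \<omega> \<le> t" "t \<le> T (Suc n) \<omega>" "0 \<le> s" "s \<le> t" for n t
    using that
  proof (induction n arbitrary: t)
    case 0
    then show ?case using within[of 0 s t] T_0[OF \<omega>] by simp
  next
    case (Suc n)
    show ?case
    proof (cases "T (Suc n) \<omega> \<le> s")
      case True
      then show ?thesis using within Suc.prems by blast
    next
      case False
      have "T n \<omega> \<le> T (Suc n) \<omega>"
        using strict_monoD[OF T_strict_mono[OF \<omega>], of n "Suc n"] by simp
      then have "\<bar>P0 \<bullet> X (T (Suc n) \<omega>) \<omega> - P0 \<bullet> X s \<omega>\<bar> \<le> c * (T (Suc n) \<omega> - s)"
        using Suc.IH[of "T (Suc n) \<omega>"] Suc.prems False by simp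
      moreover have "\<bar>P0 \<bullet> X t \<omega> - P0 \<bullet> X (T (Suc n) \<omega>) \<omega>\<bar> \<le> c * (t - T (Suc n) \<omega>)"
        using within[of "Suc n" "T (Suc n) \<omega>" t] Suc.prems by simp
      ultimately show ?thesis by (simp add: algebra_simps)
    qed
  qed
  then show ?thesis using turning_times_N[OF \<omega>, of t] s by fastforce
qed

text \<open>The real part is the cosine of the distance from \<open>P0\<close>. The imaginary part is what is
  lost at a turn, and it makes the motion between turns a rotation of the complex plane.\<close>

definition complex_position :: "real \<Rightarrow> 'a \<Rightarrow> complex" where
  "complex_position t \<omega> =
     of_real (P0 \<bullet> X (T (N t \<omega>) \<omega>) \<omega>) * cis (c * (t - T (N t \<omega>) \<omega>))"

lemma Re_complex_position:
  assumes \<omega>: "\<omega> \<in> space M" and t: "0 \<le> t"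
  shows "Re (complex_position t \<omega>) = P0 \<bullet> X t \<omega>"
  using position_between_turns(1)[OF \<omega>, of "N t \<omega>" t] turning_times_N[OF \<omega> t]
  by (simp add: complex_position_def)

lemma complex_position_no_event:
  assumes "N s \<omega> = N t \<omega>"
  shows "complex_position t \<omega> = cis (c * (t - s)) * complex_position s \<omega>"
  by (simp add: complex_position_def assms cis_mult algebra_simps)

text \<open>The last event before \<open>t\<close> lies after \<open>s\<close>, so the phase
  accumulated since then is at most \<open>c * (t - s)\<close>.\<close>

lemma Im_complex_position_after_event:
  assumes \<omega>: "\<omega> \<in> space M" and st: "0 \<le> s" "s \<le> t" and event: "N s \<omega> < N t \<omega>"
  shows "\<bar>Im (complex_position t \<omega>)\<bar> \<le> c * (t - s)"
proof -
  let ?n = "N t \<omega>"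
  have "s < T ?n \<omega>"
    using turning_times_N(2)[OF \<omega> st(1)] event
      monoD[OF strict_mono_mono[OF T_strict_mono[OF \<omega>]], of "Suc (N s \<omega>)" ?n] by simp
  then have d: "0 \<le> t - T ?n \<omega>" "t - T ?n \<omega> \<le> t - s"
    using turning_times_N(1)[OF \<omega>, of t] st by auto
  have "\<bar>Im (complex_position t \<omega>)\<bar> = \<bar>P0 \<bullet> X (T ?n \<omega>) \<omega>\<bar> * \<bar>sin (c * (t - T ?n \<omega>))\<bar>"
    by (simp add: complex_position_def abs_mult)
  also have "\<dots> \<le> 1 * (c * (t - T ?n \<omega>))"
    using Cauchy_Schwarz_ineq2[of P0 "X (T ?n \<omega>) \<omega>"] norm_P0 norm_turning_point[OF \<omega>]
      abs_sin_x_le_abs_x[of "c * (t - T ?n \<omega>)"] d c_pos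
    by (intro mult_mono) (auto simp: abs_mult)
  also have "\<dots> \<le> c * (t - s)" using d c_pos by simp
  finally show ?thesis .
qed

text \<open>In a cell without events both numbers rotate by the same angle and the error keeps its
  norm. In any other cell the exact real part moves by at most \<open>c * h\<close> and the exact
  imaginary part ends at most \<open>c * h\<close> from 0, so the error grows by at most
  \<open>2 * c * h\<close>.\<close>

lemma grid_walk_error:
  assumes \<omega>: "\<omega> \<in> space M" and h: "0 \<le> h"
  defines "d \<equiv> \<lambda>i. N (real (Suc i) * h) \<omega> - N (real i * h) \<omega>"
  shows "norm (complex_position (real j * h) \<omega> - grid_walk (c * h) d j)
     \<le> 2 * (c * h) * N (real j * h) \<omega>"
proof (induction j)
  case 0
  show ?case using T_0[OF \<omega>] X_0[OF \<omega>] N_0[OF \<omega>] norm_P0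
    by (simp add: complex_position_def dot_square_norm)
next
  case (Suc j)
  let ?s = "real j * h" and ?t = "real (Suc j) * h"
  let ?G = "grid_walk (c * h) d j"
  have st: "0 \<le> ?s" "?s \<le> ?t" "?t - ?s = h" using h by (auto simp: algebra_simps)
  have mono: "N ?s \<omega> \<le> N ?t \<omega>" by (rule N_mono[OF \<omega> st(1,2)])
  show ?case
  proof (cases "N ?s \<omega> = N ?t \<omega>")
    case True
    then have "complex_position ?t \<omega> - grid_walk (c * h) d (Suc j) =
        cis (c * h) * (complex_position ?s \<omega> - ?G)"
      using complex_position_no_event[OF True] st(3) by (simp add: d_def right_diff_distrib del: of_nat_Suc)
    then show ?thesis using Suc True by (simp add: norm_mult del: of_nat_Suc grid_walk.simps)
  next
    case False
    with mono have event: "N ?s \<omega> < N ?t \<omega>" by simp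
    then have G: "grid_walk (c * h) d (Suc j) = of_real (Re ?G)" by (simp add: d_def)
    have "norm (complex_position ?t \<omega> - grid_walk (c * h) d (Suc j))
        \<le> \<bar>Re (complex_position ?t \<omega>) - Re ?G\<bar> + \<bar>Im (complex_position ?t \<omega>)\<bar>"
      unfolding G by (rule order_trans[OF cmod_le]) simp
    also have "\<bar>Re (complex_position ?t \<omega>) - Re ?G\<bar> \<le>
        \<bar>P0 \<bullet> X ?t \<omega> - P0 \<bullet> X ?s \<omega>\<bar> + \<bar>Re (complex_position ?s \<omega> - ?G)\<bar>"
      using st by (simp add: Re_complex_position[OF \<omega>] del: of_nat_Suc)
    also have "\<dots> \<le> c * h + 2 * (c * h) * N ?s \<omega>"
      using P0_inner_lipschitz[OF \<omega> st(1,2)] unfolding st(3)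
      by (rule add_mono) (rule order_trans[OF abs_Re_le_cmod Suc])
    also have "\<bar>Im (complex_position ?t \<omega>)\<bar> \<le> c * h"
      using Im_complex_position_after_event[OF \<omega> st(1,2) event] st(3) by simp
    finally have "norm (complex_position ?t \<omega> - grid_walk (c * h) d (Suc j))
        \<le> 2 * (c * h) * (real (N ?s \<omega>) + 1)"
      by (simp add: algebra_simps)
    \<comment> \<open>A cell with events raises the count by at least one, which pays for its
      error.\<close>
    also have "\<dots> \<le> 2 * (c * h) * N ?t \<omega>"
      using event h c_pos by (intro mult_left_mono) auto
    finally show ?thesis .
  qed
qed

lemma cos_sphere_dist_position:
  assumes \<omega>: "\<omega> \<in> space M" and t: "0 \<le> t"
  shows "cos (sphere_dist P0 (X t \<omega>)) = P0 \<bullet> X t \<omega>"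
  using turning_times_N[OF \<omega> t]
  by (intro cos_sphere_dist norm_P0 position_between_turns(2)[OF \<omega>, of "N t \<omega>"]) auto

text \<open>The means of the walks on finer and finer grids have two limits: the mean of the motion,
  by dominated convergence, and \<open>e t\<close>, by the one-step scheme. The time 0 is separate
  because the cells must have positive length.\<close>

lemma mean_cos_dist_eq:
  assumes e: "\<And>s. (e has_real_derivative f s) (at s)"
    and f: "\<And>s. (f has_real_derivative - rate * f s - c\<^sup>2 * e s) (at s)"
    and init: "e 0 = 1" "f 0 = 0" and t: "0 \<le> t"
  shows "mean_cos_dist M P0 X t = e t"
proof -
  define B where "B = (\<lambda>m. turn_step (exp (- (rate * (t / Suc m)))) (c * (t / Suc m)))"
  define d where "d = (\<lambda>m \<omega> i. N (real (Suc i) * (t / Suc m)) \<omega> - N (real i * (t / Suc m)) \<omega>)"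
  define g where "g = (\<lambda>m \<omega>. grid_walk (c * (t / Suc m)) (d m \<omega>) (Suc m))"
  have mean: "mean_cos_dist M P0 X t = (\<integral>\<omega>. P0 \<bullet> X t \<omega> \<partial>M)"
    unfolding mean_cos_dist_def
    by (intro Bochner_Integration.integral_cong refl cos_sphere_dist_position t)
  show ?thesis
  proof (cases "t = 0")
    case True
    have "(\<integral>\<omega>. P0 \<bullet> X t \<omega> \<partial>M) = (\<integral>\<omega>. 1 \<partial>M)"
      by (intro Bochner_Integration.integral_cong refl) (simp add: True X_0 dot_square_norm norm_P0)
    then show ?thesis using mean init True by (simp add: prob_space)
  next
    case False
    have g: "g m \<in> borel_measurable M" "(\<integral>\<omega>. g m \<omega> \<partial>M) = (B m ^^ Suc m) 1" for m
      using expectation_grid_walk[of "t / Suc m" "c * (t / Suc m)" "Suc m"] t False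
      by (simp_all add: g_def d_def B_def del: of_nat_Suc grid_walk.simps funpow.simps)
    have "(\<lambda>m. \<integral>\<omega>. Re (g m \<omega>) \<partial>M) \<longlonglongrightarrow> (\<integral>\<omega>. P0 \<bullet> X t \<omega> \<partial>M)"
    proof (rule integral_dominated_convergence[where w = "\<lambda>_. 1"])
      show "AE \<omega> in M. (\<lambda>m. Re (g m \<omega>)) \<longlonglongrightarrow> P0 \<bullet> X t \<omega>"
      proof (rule AE_I2)
        fix \<omega> assume \<omega>: "\<omega> \<in> space M"
        \<comment> \<open>The bound depends on the path through \<open>N t \<omega>\<close>;
          convergence is pointwise, with the constant 1 as dominating function.\<close>
        have "\<bar>Re (g m \<omega>) - P0 \<bullet> X t \<omega>\<bar> \<le> 2 * (c * t) * N t \<omega> / Suc m" for m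
        proof -
          have "norm (complex_position t \<omega> - g m \<omega>) \<le> 2 * (c * (t / Suc m)) * N t \<omega>"
            using grid_walk_error[OF \<omega>, of "t / Suc m" "Suc m"] t
            by (simp add: g_def d_def del: of_nat_Suc grid_walk.simps)
          then show ?thesis
            using abs_Re_le_cmod[of "complex_position t \<omega> - g m \<omega>"] Re_complex_position[OF \<omega> t]
            by (simp add: abs_minus_commute del: of_nat_Suc)
        qed
        then show "(\<lambda>m. Re (g m \<omega>)) \<longlonglongrightarrow> P0 \<bullet> X t \<omega>"
          by (rule LIMSEQ_from_inverse_bound)
      qed
      show "AE \<omega> in M. norm (Re (g m \<omega>)) \<le> 1" for m
        unfolding g_def using order_trans[OF abs_Re_le_cmod norm_grid_walk_le]
        by (intro AE_I2) (simp del: grid_walk.simps)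
    qed (use g X_measurable[OF t] in auto)
    moreover have "(\<lambda>m. \<integral>\<omega>. Re (g m \<omega>) \<partial>M) = (\<lambda>m. Re ((B m ^^ Suc m) 1))"
    proof
      fix m
      have "integrable M (g m)"
        using g(1) norm_grid_walk_le unfolding g_def
        by (intro integrable_const_bound[where B = 1]) (auto simp del: grid_walk.simps)
      then show "(\<integral>\<omega>. Re (g m \<omega>) \<partial>M) = Re ((B m ^^ Suc m) 1)"
        by (simp only: integral_Re g(2))
    qed
    moreover have "(\<lambda>m. Re ((B m ^^ Suc m) 1)) \<longlonglongrightarrow> e t"
      unfolding B_def
    \<comment> \<open>With \<open>f\<close> the derivative of \<open>e\<close>, the choice
      \<open>z = - f / c\<close> turns the second-order equation into the first-order
      system.\<close>
    proof (rule turn_step_iterate_tendsto[where z = "\<lambda>s. - f s / c"])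
      show "(e has_real_derivative - c * (- f s / c)) (at s)" for s
        using e[of s] c_pos by simp
      show "((\<lambda>s. - f s / c) has_real_derivative c * e s - rate * (- f s / c)) (at s)" for s
        using c_pos
        by (auto intro!: derivative_eq_intros f simp: field_simps power2_eq_square)
    qed (use rate_pos c_pos init t in auto)
    ultimately show ?thesis using mean LIMSEQ_unique by metis
  qed
qed

end

subsection \<open>Closed forms\<close>

text \<open>The characteristic roots are \<open>(- r + q) / 2\<close> and
  \<open>(- r - q) / 2\<close>. In the derivative of \<open>e\<close> the \<open>cosh\<close> terms
  cancel, and the coefficient of \<open>sinh\<close> is
  \<open>(q^2 - r^2) / (2 * q) = - 2 * c^2 / q\<close>.\<close>

lemma overdamped_solution:
  fixes r q c :: real
  assumes "q \<noteq> 0" "q\<^sup>2 = r\<^sup>2 - 4 * c\<^sup>2"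
  defines "e \<equiv> \<lambda>t. exp (- (r * t / 2)) * (cosh (t / 2 * q) + r / q * sinh (t / 2 * q))"
    and "f \<equiv> \<lambda>t. - (2 * c\<^sup>2 / q) * (exp (- (r * t / 2)) * sinh (t / 2 * q))"
  shows "(e has_real_derivative f t) (at t)"
    and "(f has_real_derivative - r * f t - c\<^sup>2 * e t) (at t)"
proof -
  define x where "x = exp (- (r * t / 2))"
  define C where "C = cosh (t / 2 * q)"
  define S where "S = sinh (t / 2 * q)"
  have c2: "c\<^sup>2 = (r\<^sup>2 - q\<^sup>2) / 4" using assms by simp
  have "(e has_real_derivative - (r / 2) * x * (C + r / q * S) + x * (q / 2 * S + r / q * (q / 2 * C))) (at t)"
    using assms(1) unfolding e_def x_def C_def S_def
    by (auto intro!: derivative_eq_intros simp: field_simps)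
  also have "- (r / 2) * x * (C + r / q * S) + x * (q / 2 * S + r / q * (q / 2 * C)) = f t"
    using assms(1) unfolding f_def c2 x_def[symmetric] S_def[symmetric]
    by (simp add: field_simps power2_eq_square)
  finally show "(e has_real_derivative f t) (at t)" .
  have "(f has_real_derivative - (2 * c\<^sup>2 / q) * (- (r / 2) * x * S + x * (q / 2 * C))) (at t)"
    using assms(1) unfolding f_def x_def C_def S_def
    by (auto intro!: derivative_eq_intros simp: field_simps)
  also have "- (2 * c\<^sup>2 / q) * (- (r / 2) * x * S + x * (q / 2 * C)) = - r * f t - c\<^sup>2 * e t"
    using assms(1) unfolding f_def e_def x_def[symmetric] S_def[symmetric] C_def[symmetric]
    by (simp add: field_simps)
  finally show "(f has_real_derivative - r * f t - c\<^sup>2 * e t) (at t)" .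
qed

text \<open>The preceding computation with \<open>q\<close> replaced by \<open>i q\<close>, for
  complex conjugate roots.\<close>

lemma underdamped_solution:
  fixes r q c :: real
  assumes "q \<noteq> 0" "q\<^sup>2 = 4 * c\<^sup>2 - r\<^sup>2"
  defines "e \<equiv> \<lambda>t. exp (- (r * t / 2)) * (cos (t / 2 * q) + r / q * sin (t / 2 * q))"
    and "f \<equiv> \<lambda>t. - (2 * c\<^sup>2 / q) * (exp (- (r * t / 2)) * sin (t / 2 * q))"
  shows "(e has_real_derivative f t) (at t)"
    and "(f has_real_derivative - r * f t - c\<^sup>2 * e t) (at t)"
proof -
  define x where "x = exp (- (r * t / 2))"
  define C where "C = cos (t / 2 * q)"
  define S where "S = sin (t / 2 * q)"
  have c2: "c\<^sup>2 = (r\<^sup>2 + q\<^sup>2) / 4" using assms by simp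
  have "(e has_real_derivative - (r / 2) * x * (C + r / q * S) + x * (- (q / 2 * S) + r / q * (q / 2 * C))) (at t)"
    using assms(1) unfolding e_def x_def C_def S_def
    by (auto intro!: derivative_eq_intros simp: field_simps)
  also have "- (r / 2) * x * (C + r / q * S) + x * (- (q / 2 * S) + r / q * (q / 2 * C)) = f t"
    using assms(1) unfolding f_def c2 x_def[symmetric] S_def[symmetric]
    by (simp add: field_simps power2_eq_square)
  finally show "(e has_real_derivative f t) (at t)" .
  have "(f has_real_derivative - (2 * c\<^sup>2 / q) * (- (r / 2) * x * S + x * (q / 2 * C))) (at t)"
    using assms(1) unfolding f_def x_def C_def S_def
    by (auto intro!: derivative_eq_intros simp: field_simps)
  also have "- (2 * c\<^sup>2 / q) * (- (r / 2) * x * S + x * (q / 2 * C)) = - r * f t - c\<^sup>2 * e t"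
    using assms(1) unfolding f_def e_def x_def[symmetric] S_def[symmetric] C_def[symmetric]
    by (simp add: field_simps)
  finally show "(f has_real_derivative - r * f t - c\<^sup>2 * e t) (at t)" .
qed

text \<open>The double root \<open>- r / 2\<close>, the limit of either other case as
  \<open>q\<close> tends to 0.\<close>

lemma critically_damped_solution:
  fixes r c :: real
  assumes "r = 2 * c"
  defines "e \<equiv> \<lambda>t. exp (- (r * t / 2)) * (1 + r * t / 2)"
    and "f \<equiv> \<lambda>t. - c\<^sup>2 * (t * exp (- (r * t / 2)))"
  shows "(e has_real_derivative f t) (at t)"
    and "(f has_real_derivative - r * f t - c\<^sup>2 * e t) (at t)"
  unfolding e_def f_def assms(1)
  by (auto intro!: derivative_eq_intros simp: algebra_simps power2_eq_square)

section \<open>Transfer of the differential equation from the closed forms to the mean\<close>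

theorem theorem6p1:
  fixes M :: "'a measure"
    and rate c :: real
    and N :: "real \<Rightarrow> 'a \<Rightarrow> nat"
    and T :: "nat \<Rightarrow> 'a \<Rightarrow> real"
    and P0 :: "real^3"
    and C :: "nat \<Rightarrow> 'a \<Rightarrow> (real^3) set"
    and V :: "nat \<Rightarrow> 'a \<Rightarrow> real^3"
    and X :: "real \<Rightarrow> 'a \<Rightarrow> real^3"
    and E :: "real \<Rightarrow> real"
  assumes motion: "orthogonal_sphere_motion M rate N c T P0 C V X"
    and E_def: "E = mean_cos_dist M P0 X"
  shows "(\<forall>t>0. (E has_real_derivative deriv E t) (at t) \<and>
              (deriv E has_real_derivative (- rate * deriv E t - c\<^sup>2 * E t)) (at t)) \<and>
         E 0 = 1 \<and>
         (E has_real_derivative 0) (at_right 0) \<and>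
         (\<forall>t\<ge>0.
            (2 * c < rate \<longrightarrow>
               E t = exp (- (rate * t / 2)) *
                 (cosh (t / 2 * sqrt (rate\<^sup>2 - 4 * c\<^sup>2)) +
                  rate / sqrt (rate\<^sup>2 - 4 * c\<^sup>2) * sinh (t / 2 * sqrt (rate\<^sup>2 - 4 * c\<^sup>2)))) \<and>
            (rate = 2 * c \<longrightarrow>
               E t = exp (- (rate * t / 2)) * (1 + rate * t / 2)) \<and>
            (2 * c > rate \<longrightarrow>
               E t = exp (- (rate * t / 2)) *
                 (cos (t / 2 * sqrt (4 * c\<^sup>2 - rate\<^sup>2)) +
                  rate / sqrt (4 * c\<^sup>2 - rate\<^sup>2) * sin (t / 2 * sqrt (4 * c\<^sup>2 - rate\<^sup>2)))))"
proof -
  interpret orthogonal_sphere_motion M rate N c T P0 C V X by (rule motion)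
  let ?ode = "\<lambda>e f. (\<forall>s. (e has_real_derivative f s) (at s)) \<and>
    (\<forall>s. (f has_real_derivative - rate * f s - c\<^sup>2 * e s) (at s)) \<and> e 0 = 1 \<and> f 0 = (0::real)"
  \<comment> \<open>The solutions satisfy the equation on the whole line, but \<open>E\<close> is
    identified with them only for \<open>t \<ge> 0\<close>. Derivatives are therefore transferred on
    the open half-line, and one-sidedly at 0.\<close>
  have E_eq: "E t = e t" if "?ode e f" "0 \<le> t" for e f t
    using that mean_cos_dist_eq[of e f t] by (simp add: E_def)
  let ?p = "sqrt (rate\<^sup>2 - 4 * c\<^sup>2)" and ?q = "sqrt (4 * c\<^sup>2 - rate\<^sup>2)"
  define e1 where "e1 = (\<lambda>t. exp (- (rate * t / 2)) * (cosh (t / 2 * ?p) + rate / ?p * sinh (t / 2 * ?p)))"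
  define f1 where "f1 = (\<lambda>t. - (2 * c\<^sup>2 / ?p) * (exp (- (rate * t / 2)) * sinh (t / 2 * ?p)))"
  define e2 where "e2 = (\<lambda>t. exp (- (rate * t / 2)) * (1 + rate * t / 2))"
  define f2 where "f2 = (\<lambda>t. - c\<^sup>2 * (t * exp (- (rate * t / 2))))"
  define e3 where "e3 = (\<lambda>t. exp (- (rate * t / 2)) * (cos (t / 2 * ?q) + rate / ?q * sin (t / 2 * ?q)))"
  define f3 where "f3 = (\<lambda>t. - (2 * c\<^sup>2 / ?q) * (exp (- (rate * t / 2)) * sin (t / 2 * ?q)))"
  have ode1: "?ode e1 f1" if "2 * c < rate"
  proof -
    \<comment> \<open>The radicand is positive, so the root is a nonzero divisor.\<close>
    have "(2 * c)\<^sup>2 < rate\<^sup>2" using that c_pos by (intro power_strict_mono) auto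
    then have "?p \<noteq> 0" "?p\<^sup>2 = rate\<^sup>2 - 4 * c\<^sup>2" by (auto simp: power_mult_distrib)
    then show ?thesis using overdamped_solution[of ?p rate c] by (simp add: e1_def f1_def)
  qed
  have ode2: "?ode e2 f2" if "rate = 2 * c"
    using critically_damped_solution[OF that] by (simp add: e2_def f2_def)
  have ode3: "?ode e3 f3" if "rate < 2 * c"
  proof -
    have "rate\<^sup>2 < (2 * c)\<^sup>2" using that rate_pos by (intro power_strict_mono) auto
    then have "?q \<noteq> 0" "?q\<^sup>2 = 4 * c\<^sup>2 - rate\<^sup>2" by (auto simp: power_mult_distrib)
    then show ?thesis using underdamped_solution[of ?q c rate] by (simp add: e3_def f3_def)
  qed
  \<comment> \<open>Exactly one damping case occurs; its solution serves for all statements about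
    derivatives.\<close>
  obtain e f where ode: "?ode e f"
    using ode1 ode2 ode3 by (metis linorder_neqE_linordered_idom)
  have dE: "(E has_real_derivative f t) (at t)" if "0 < t" for t
    by (rule has_field_derivative_transform_within_open[of e _ _ "{0<..}"])
       (use ode that E_eq[OF ode] in auto)
  have deriv_E: "deriv E t = f t" if "0 < t" for t
    using dE[OF that] by (rule DERIV_imp_deriv)
  have ddE: "(deriv E has_real_derivative - rate * deriv E t - c\<^sup>2 * E t) (at t)" if "0 < t" for t
  proof -
    have "(f has_real_derivative - rate * deriv E t - c\<^sup>2 * E t) (at t)"
      using ode that E_eq[OF ode] deriv_E by simp
    then show ?thesis
      by (rule has_field_derivative_transform_within_open[of _ _ _ "{0<..}"]) (use that deriv_E in auto)
  qed
  have dE0: "(E has_real_derivative 0) (at_right 0)"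
  proof (rule DERIV_subset[where s = "{0..}"])
    have "(e has_real_derivative 0) (at 0 within {0..})"
      using ode by (metis has_field_derivative_at_within)
    then show "(E has_real_derivative 0) (at 0 within {0..})"
      by (rule has_field_derivative_transform_within[where d = 1]) (use E_eq[OF ode] in auto)
  qed auto
  have "E 0 = 1" using E_eq[OF ode, of 0] ode by simp
  moreover have "E t = e1 t" if "2 * c < rate" "0 \<le> t" for t using E_eq[OF ode1] that by blast
  moreover have "E t = e2 t" if "rate = 2 * c" "0 \<le> t" for t using E_eq[OF ode2] that by blast
  moreover have "E t = e3 t" if "rate < 2 * c" "0 \<le> t" for t using E_eq[OF ode3] that by blast
  ultimately show ?thesis
    using dE ddE dE0 deriv_E by (simp add: e1_def e2_def e3_def)
qed

end
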